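(* Let $\Omega$ be a compact subset of $\mathbb R^d$, $\mu$ a probability measure on $\Omega$, and $1\le p<\infty$. Let $m,v,N$ be natural numbers such that $v\le N$, and let $\mathcal D_N=\{g_i\}_{i=1}^N\subset\mathcal C(\Omega)$ be a system of $N$ elements. Assume that there exist a number $D\ge1$ and a set of points $\xi:=\{\xi^j\}_{j=1}^m\subset\Omega$ such that $$\|g\|_p\le D\max_{1\le j\le m}|g(\xi^j)|\qquad\text{for any } g\in\bigcup_{V\in\mathcal X_v(\mathcal D_N)}V.$$ Then for any function $f\in\mathcal C(\Omega)$ we have $$\|f-\ell(p,\infty)(\xi,\mathcal X_v(\mathcal D_N))(f)\|_p\le(2D+1)\,\sigma_v(f,\mathcal D_N)_\infty .$$
   Context: $\mathcal C(\Omega)$ is the space of continuous functions on $\Omega$; $\|f\|_p=\left(\int_\Omega|f|^p\,d\mu\right)^{1/p}$, $\|f\|_\infty=\sup_{\omega\in\Omega}|f(\omega)|$. For $v\le N$, $\mathcal X_v(\mathcal D_N)$ is the collection of all linear spaces spanned by $\{g_j\}_{j\in J}$ with $J\subset\{1,\dots,N\}$, $|J|=v$; $\Sigma_v(\mathcal D_N):=\bigcup_{V\in\mathcal X_v(\mathcal D_N)}V$ is the set of $v$-term approximants; and $\sigma_v(f,\mathcal D_N)_\infty:=\inf_{g\in\Sigma_v(\mathcal D_N)}\|f-g\|_\infty$. For a finite-dimensional subspace $L\subset\mathcal C(\Omega)$, $\ell\infty(\xi,L)(f):=\arg\min_{u\in L}\max_{1\le j\le m}|f(\xi^j)-u(\xi^j)|$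 (any fixed minimizer). Algorithm $\ell(p,\infty)$ is defined by $$L(\xi,f):=\arg\min_{L\in\mathcal X_v(\mathcal D_N)}\|f-\ell\infty(\xi,L)(f)\|_p,\qquad \ell(p,\infty)(\xi,\mathcal X_v(\mathcal D_N))(f):=\ell\infty(\xi,L(\xi,f))(f).$$ *)

theory Defs
  imports "HOL-Probability.Probability"
begin

text \<open>
  Functions on a compact set \<open>\<Omega>\<close> are represented by total functions \<open>'a \<Rightarrow> 'k\<close> that are
  \<open>continuous_on \<Omega>\<close>; none of the norms below depends on the values outside \<open>\<Omega>\<close>
  (for \<open>lp_norm\<close> provided \<open>space \<mu> = \<Omega>\<close>).  The scalar class
  \<open>real_normed_field\<close> covers both real and complex scalars.
\<close>

definition lp_norm :: "'a measure \<Rightarrow> real \<Rightarrow> ('a \<Rightarrow> 'k::real_normed_field) \<Rightarrow> real" where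
  "lp_norm \<mu> p f = (\<integral>x. norm (f x) powr p \<partial>\<mu>) powr (1 / p)"

definition sup_norm :: "'a set \<Rightarrow> ('a \<Rightarrow> 'k::real_normed_field) \<Rightarrow> real" where
  "sup_norm \<Omega> f = (SUP x\<in>\<Omega>. norm (f x))"

definition max_norm :: "nat \<Rightarrow> (nat \<Rightarrow> 'a) \<Rightarrow> ('a \<Rightarrow> 'k::real_normed_field) \<Rightarrow> real" where
  "max_norm m \<xi> f = Max ((\<lambda>j. norm (f (\<xi> j))) ` {1..m})"

definition lin_span :: "(nat \<Rightarrow> 'a \<Rightarrow> 'k::real_normed_field) \<Rightarrow> nat set \<Rightarrow> ('a \<Rightarrow> 'k) set" where
  "lin_span g J = {\<lambda>x. \<Sum>j\<in>J. c j * g j x | c. True}"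

definition vterm_spaces ::
    "(nat \<Rightarrow> 'a \<Rightarrow> 'k::real_normed_field) \<Rightarrow> nat \<Rightarrow> nat \<Rightarrow> ('a \<Rightarrow> 'k) set set" where
  "vterm_spaces g N v = {lin_span g J | J. J \<subseteq> {1..N} \<and> card J = v}"

definition vterm_approximants ::
    "(nat \<Rightarrow> 'a \<Rightarrow> 'k::real_normed_field) \<Rightarrow> nat \<Rightarrow> nat \<Rightarrow> ('a \<Rightarrow> 'k) set" where
  "vterm_approximants g N v = \<Union> (vterm_spaces g N v)"

definition best_vterm_error ::
    "'a set \<Rightarrow> (nat \<Rightarrow> 'a \<Rightarrow> 'k::real_normed_field) \<Rightarrow> nat \<Rightarrow> nat \<Rightarrow> ('a \<Rightarrow> 'k) \<Rightarrow> real" where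
  "best_vterm_error \<Omega> g N v f =
     (INF h\<in>vterm_approximants g N v. sup_norm \<Omega> (\<lambda>x. f x - h x))"

text \<open>
  The two arg min's of the algorithm need not be unique.  Instead of singling out one
  minimizer, the algorithm is parametrized by arbitrary operators \<open>A\<close> (choosing \<open>A L f\<close> in \<open>L\<close>)
  and \<open>S\<close> (choosing the space \<open>S f\<close>) that pick a minimizer for every continuous \<open>f\<close>.
  Such operators always exist: see \<open>linf_selector_exists\<close> and \<open>space_selector_exists\<close> below.
\<close>

definition linf_selector ::
    "'a::topological_space set \<Rightarrow> nat \<Rightarrow> (nat \<Rightarrow> 'a) \<Rightarrow> ('a \<Rightarrow> 'k::real_normed_field) set set \<Rightarrow>
     (('a \<Rightarrow> 'k) set \<Rightarrow> ('a \<Rightarrow> 'k) \<Rightarrow> 'a \<Rightarrow> 'k) \<Rightarrow> bool" where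
  "linf_selector \<Omega> m \<xi> \<X> A \<longleftrightarrow>
     (\<forall>L\<in>\<X>. \<forall>f. continuous_on \<Omega> f \<longrightarrow>
        is_arg_min (\<lambda>u. max_norm m \<xi> (\<lambda>x. f x - u x)) (\<lambda>u. u \<in> L) (A L f))"

definition space_selector ::
    "'a::topological_space set \<Rightarrow> 'a measure \<Rightarrow> real \<Rightarrow> ('a \<Rightarrow> 'k::real_normed_field) set set \<Rightarrow>
     (('a \<Rightarrow> 'k) set \<Rightarrow> ('a \<Rightarrow> 'k) \<Rightarrow> 'a \<Rightarrow> 'k) \<Rightarrow> (('a \<Rightarrow> 'k) \<Rightarrow> ('a \<Rightarrow> 'k) set) \<Rightarrow> bool" where
  "space_selector \<Omega> \<mu> p \<X> A S \<longleftrightarrow>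
     (\<forall>f. continuous_on \<Omega> f \<longrightarrow>
        is_arg_min (\<lambda>L. lp_norm \<mu> p (\<lambda>x. f x - A L f x)) (\<lambda>L. L \<in> \<X>) (S f))"

definition alg_lp_inf ::
    "(('a \<Rightarrow> 'k) set \<Rightarrow> ('a \<Rightarrow> 'k) \<Rightarrow> 'a \<Rightarrow> 'k) \<Rightarrow> (('a \<Rightarrow> 'k) \<Rightarrow> ('a \<Rightarrow> 'k) set) \<Rightarrow>
     ('a \<Rightarrow> 'k) \<Rightarrow> 'a \<Rightarrow> 'k" where
  "alg_lp_inf A S f = A (S f) f"


lemma max_norm_le_iff:
  "1 \<le> m \<Longrightarrow> max_norm m \<xi> f \<le> b \<longleftrightarrow> (\<forall>j\<in>{1..m}. norm (f (\<xi> j)) \<le> b)"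
  unfolding max_norm_def by (subst Max_le_iff) auto

lemma norm_le_max_norm: "j \<in> {1..m} \<Longrightarrow> norm (f (\<xi> j)) \<le> max_norm m \<xi> f"
  unfolding max_norm_def by (intro Max_ge) auto

lemma max_norm_triangle:
  assumes "1 \<le> m" "\<And>x. h x = f x + g x"
  shows "max_norm m \<xi> h \<le> max_norm m \<xi> f + max_norm m \<xi> g"
  unfolding max_norm_le_iff[OF assms(1)] assms(2)
  by (meson add_mono norm_le_max_norm norm_triangle_le)

lemma max_norm_nonneg: "1 \<le> m \<Longrightarrow> 0 \<le> max_norm m \<xi> f"
  using order_trans[OF norm_ge_zero norm_le_max_norm[of 1 m f \<xi>]] by simp

lemma max_norm_scale_le:
  assumes "1 \<le> m"
  shows "max_norm m \<xi> (\<lambda>x. c * f x) \<le> norm c * max_norm m \<xi> f"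
  unfolding max_norm_le_iff[OF assms] by (auto simp: norm_mult intro!: mult_left_mono norm_le_max_norm)

lemma lin_span_add:
  assumes "u \<in> lin_span g J" "w \<in> lin_span g J"
  shows "(\<lambda>x. c * u x + w x) \<in> lin_span g J"
proof -
  from assms obtain a b where "u = (\<lambda>x. \<Sum>j\<in>J. a j * g j x)" "w = (\<lambda>x. \<Sum>j\<in>J. b j * g j x)"
    unfolding lin_span_def by blast
  hence "(\<lambda>x. c * u x + w x) = (\<lambda>x. \<Sum>j\<in>J. (c * a j + b j) * g j x)"
    by (auto simp: sum_distrib_left sum.distrib algebra_simps)
  thus ?thesis unfolding lin_span_def mem_Collect_eq by (intro exI[of _ "\<lambda>j. c * a j + b j"]) simp
qed

lemma lin_span_zero: "(\<lambda>x. 0) \<in> lin_span g J"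
  unfolding lin_span_def by (auto intro!: exI[of _ "\<lambda>_. 0"])

lemma lin_span_insert:
  assumes "finite J" "k \<notin> J"
  shows "lin_span g (insert k J) = {\<lambda>x. t * g k x + w x | t w. w \<in> lin_span g J}"
proof (intro set_eqI iffI)
  fix u assume "u \<in> lin_span g (insert k J)"
  then obtain c where "u = (\<lambda>x. \<Sum>j\<in>insert k J. c j * g j x)" unfolding lin_span_def by blast
  hence "u = (\<lambda>x. c k * g k x + (\<Sum>j\<in>J. c j * g j x))" using assms by simp
  moreover have "(\<lambda>x. \<Sum>j\<in>J. c j * g j x) \<in> lin_span g J" unfolding lin_span_def by blast
  ultimately show "u \<in> {\<lambda>x. t * g k x + w x | t w. w \<in> lin_span g J}"
    unfolding mem_Collect_eq by (intro exI conjI)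
next
  fix u assume "u \<in> {\<lambda>x. t * g k x + w x | t w. w \<in> lin_span g J}"
  then obtain t c where u: "u = (\<lambda>x. t * g k x + (\<Sum>j\<in>J. c j * g j x))"
    unfolding lin_span_def by blast
  have "(\<Sum>j\<in>J. c j * g j x) = (\<Sum>j\<in>J. (c(k := t)) j * g j x)" for x
    using assms by (intro sum.cong) auto
  hence "u = (\<lambda>x. \<Sum>j\<in>insert k J. (c(k := t)) j * g j x)" using assms u by simp
  thus "u \<in> lin_span g (insert k J)" unfolding lin_span_def by blast
qed

lemma max_norm_minimizer_exists:
  fixes g :: "nat \<Rightarrow> 'a \<Rightarrow> 'k::{real_normed_field, heine_borel}"
  assumes "finite J" and m: "1 \<le> m"
  shows "\<exists>u\<in>lin_span g J. \<forall>w\<in>lin_span g J.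
           max_norm m \<xi> (\<lambda>x. f x - u x) \<le> max_norm m \<xi> (\<lambda>x. f x - w x)"
  using assms(1)
proof (induction J arbitrary: f rule: finite_induct)
  case empty
  have "lin_span g {} = {\<lambda>x. 0}" unfolding lin_span_def by auto
  thus ?case by simp
next
  case (insert k J)
  let ?q = "max_norm m \<xi>"
  let ?W = "lin_span g J"
  have "\<forall>b. \<exists>u. u \<in> ?W \<and> (\<forall>w\<in>?W. ?q (\<lambda>x. b x - u x) \<le> ?q (\<lambda>x. b x - w x))"
    using insert.IH by blast
  from choice[OF this] obtain P
    where P: "\<And>b. P b \<in> ?W \<and> (\<forall>w\<in>?W. ?q (\<lambda>x. b x - P b x) \<le> ?q (\<lambda>x. b x - w x))" by blast
  define d where "d = (\<lambda>b. ?q (\<lambda>x. b x - P b x))"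
  have PW: "P b \<in> ?W" and dle: "w \<in> ?W \<Longrightarrow> d b \<le> ?q (\<lambda>x. b x - w x)" for b w
    using P[of b] unfolding d_def by auto
  have d0: "0 \<le> d b" for b unfolding d_def by (rule max_norm_nonneg[OF m])
  have dlip: "d b \<le> ?q (\<lambda>x. b x - b' x) + d b'" for b b'
  proof -
    have "d b \<le> ?q (\<lambda>x. b x - P b' x)" by (rule dle[OF PW])
    also have "\<dots> \<le> ?q (\<lambda>x. b x - b' x) + ?q (\<lambda>x. b' x - P b' x)"
      by (rule max_norm_triangle[OF m]) simp
    finally show ?thesis unfolding d_def .
  qed
  define F where "F = (\<lambda>t. d (\<lambda>x. f x - t * g k x))"
  have Flip: "F t \<le> F s + norm (t - s) * ?q (g k)" for s t
  proof -
    have "F t \<le> ?q (\<lambda>x. (s - t) * g k x) + F s"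
      unfolding F_def using dlip[of "\<lambda>x. f x - t * g k x" "\<lambda>x. f x - s * g k x"]
      by (simp add: algebra_simps)
    also have "?q (\<lambda>x. (s - t) * g k x) \<le> norm (s - t) * ?q (g k)"
      by (rule max_norm_scale_le[OF m])
    finally show ?thesis by (simp add: norm_minus_commute)
  qed
  have "\<bar>F t - F s\<bar> \<le> ?q (g k) * norm (t - s)" for s t
    using Flip[of t s] Flip[of s t] by (simp add: norm_minus_commute mult.commute abs_le_iff)
  hence "(?q (g k))-lipschitz_on UNIV F"
    by (intro lipschitz_onI) (auto simp: dist_norm max_norm_nonneg[OF m])
  hence Fcont: "continuous_on A F" for A
    by (meson continuous_on_subset lipschitz_on_continuous_on subset_UNIV)
  have "\<exists>t0. \<forall>t. F t0 \<le> F t"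
  proof (cases "d (g k) = 0")
    case True
    have "F 0 \<le> F t" for t
    proof -
      define w where "w = P (\<lambda>x. f x - t * g k x)"
      have "F 0 \<le> ?q (\<lambda>x. f x - (t * P (g k) x + w x))"
        unfolding F_def using dle[OF lin_span_add[OF PW PW], of f] by (simp add: w_def)
      also have "\<dots> \<le> ?q (\<lambda>x. t * (g k x - P (g k) x)) + ?q (\<lambda>x. f x - t * g k x - w x)"
        by (rule max_norm_triangle[OF m]) (simp add: algebra_simps)
      also have "?q (\<lambda>x. t * (g k x - P (g k) x)) \<le> norm t * d (g k)"
        unfolding d_def by (rule max_norm_scale_le[OF m])
      finally show ?thesis using True by (simp add: F_def d_def w_def)
    qed
    thus ?thesis by blast
  next
    case False
    hence dpos: "0 < d (g k)" using d0[of "g k"] by simp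
    have coercive: "norm t * d (g k) \<le> ?q f + F t" if "t \<noteq> 0" for t
    proof -
      define w where "w = P (\<lambda>x. f x - t * g k x)"
      have "(\<lambda>x. - inverse t * w x + 0) \<in> ?W"
        unfolding w_def by (intro lin_span_add PW lin_span_zero)
      from dle[OF this, of "g k"] have "d (g k) \<le> ?q (\<lambda>x. g k x + inverse t * w x)" by simp
      also have "(\<lambda>x. g k x + inverse t * w x) = (\<lambda>x. inverse t * (t * g k x + w x))"
        using that by (auto simp: field_simps)
      also have "?q \<dots> \<le> norm (inverse t) * ?q (\<lambda>x. t * g k x + w x)"
        by (rule max_norm_scale_le[OF m])
      finally have "norm t * d (g k) \<le> ?q (\<lambda>x. t * g k x + w x)"
        using that unfolding norm_inverse
        by (simp add: divide_inverse_commute[symmetric] pos_le_divide_eq mult.commute[of "norm t"])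
      also have "\<dots> \<le> ?q f + ?q (\<lambda>x. -1 * (f x - t * g k x - w x))"
        by (rule max_norm_triangle[OF m]) simp
      also have "?q (\<lambda>x. -1 * (f x - t * g k x - w x)) \<le> norm (-1::'k) * ?q (\<lambda>x. f x - t * g k x - w x)"
        by (rule max_norm_scale_le[OF m])
      finally show ?thesis by (simp add: F_def d_def w_def)
    qed
    have F0: "F 0 \<le> ?q f" unfolding F_def using dle[OF lin_span_zero, of f] by simp
    define T where "T = 2 * ?q f / d (g k)"
    have T: "0 \<le> T" unfolding T_def using dpos max_norm_nonneg[OF m, of \<xi> f] by simp
    have "\<exists>t0\<in>cball 0 T. \<forall>t\<in>cball 0 T. F t0 \<le> F t"
      by (rule continuous_attains_inf[OF _ _ Fcont]) (use T in auto)
    then obtain t0 where t0: "\<And>t. t \<in> cball 0 T \<Longrightarrow> F t0 \<le> F t" by blast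
    have "F t0 \<le> F t" for t
    proof (cases "t \<in> cball 0 T")
      case True thus ?thesis by (rule t0)
    next
      case False
      hence "T < norm t" by simp
      hence "2 * ?q f < norm t * d (g k)" unfolding T_def using dpos by (simp add: field_simps)
      moreover have "t \<noteq> 0" using \<open>T < norm t\<close> T by auto
      ultimately have "?q f < F t" using coercive[of t] by simp
      moreover have "F t0 \<le> F 0" by (rule t0) (use T in simp)
      ultimately show ?thesis using F0 by simp
    qed
    thus ?thesis by blast
  qed
  then obtain t0 where t0: "\<And>t. F t0 \<le> F t" by blast
  let ?u = "\<lambda>x. t0 * g k x + P (\<lambda>x. f x - t0 * g k x) x"
  have "?q (\<lambda>x. f x - ?u x) \<le> ?q (\<lambda>x. f x - (t * g k x + w x))" if "w \<in> ?W" for t w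
    using order_trans[OF t0[of t, unfolded F_def] dle[OF that]] by (simp add: d_def diff_diff_eq)
  moreover have "?u \<in> {\<lambda>x. t * g k x + w x | t w. w \<in> ?W}"
    unfolding mem_Collect_eq using PW by (intro exI conjI) (rule refl)
  ultimately show ?case unfolding lin_span_insert[OF insert.hyps]
    by (intro bexI[of _ ?u] ballI) auto
qed

lemma linf_selector_exists:
  fixes g :: "nat \<Rightarrow> 'a::topological_space \<Rightarrow> 'k::{real_normed_field, heine_borel}"
  assumes "1 \<le> m"
  shows "\<exists>A. linf_selector \<Omega> m \<xi> (vterm_spaces g N v) A"
proof -
  have "\<exists>u. is_arg_min (\<lambda>u. max_norm m \<xi> (\<lambda>x. f x - u x)) (\<lambda>u. u \<in> L) u"
    if "L \<in> vterm_spaces g N v" for L f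
  proof -
    from that obtain J where "L = lin_span g J" "finite J"
      unfolding vterm_spaces_def using finite_subset by blast
    with max_norm_minimizer_exists[OF _ assms, of J g \<xi> f]
    show ?thesis unfolding is_arg_min_linorder by blast
  qed
  hence "\<forall>L. \<forall>f. \<exists>u. L \<in> vterm_spaces g N v \<longrightarrow>
           is_arg_min (\<lambda>u. max_norm m \<xi> (\<lambda>x. f x - u x)) (\<lambda>u. u \<in> L) u" by blast
  hence "\<forall>L. \<exists>a. \<forall>f. L \<in> vterm_spaces g N v \<longrightarrow>
           is_arg_min (\<lambda>u. max_norm m \<xi> (\<lambda>x. f x - u x)) (\<lambda>u. u \<in> L) (a f)"
    by (intro allI choice) blast
  from choice[OF this] show ?thesis unfolding linf_selector_def by blast
qed

lemma space_selector_exists: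
  fixes g :: "nat \<Rightarrow> 'a::topological_space \<Rightarrow> 'k::real_normed_field"
  assumes "v \<le> N"
  shows "\<exists>S. space_selector \<Omega> \<mu> p (vterm_spaces g N v) A S"
proof -
  have "vterm_spaces g N v = lin_span g ` {J. J \<subseteq> {1..N} \<and> card J = v}"
    unfolding vterm_spaces_def by blast
  hence fin: "finite (vterm_spaces g N v)" by simp
  have "lin_span g {1..v} \<in> vterm_spaces g N v" unfolding vterm_spaces_def using assms by force
  hence ne: "vterm_spaces g N v \<noteq> {}" by blast
  have "\<forall>f. \<exists>L. is_arg_min (\<lambda>L. lp_norm \<mu> p (\<lambda>x. f x - A L f x)) (\<lambda>L. L \<in> vterm_spaces g N v) L"
    using ex_is_arg_min_if_finite[OF fin ne] by blast
  from choice[OF this] show ?thesis unfolding space_selector_def by blast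
qed

end

theory Submission
  imports Defs
begin

text \<open>
  For \<open>h\<close> in one of the spaces \<open>L\<close> and \<open>u = A L f\<close>, split \<open>f - u = (f - h) + (h - u)\<close>.  The
  discretization hypothesis bounds the second summand by the maximum of \<open>\<bar>h - u\<bar>\<close> over the
  points, and since \<open>u\<close> is at least as good as \<open>h\<close> there, this is at most twice
  \<open>\<parallel>f - h\<parallel>\<^sub>\<infinity>\<close>.  The space chosen by the algorithm does at least as well as \<open>L\<close>.
\<close>

lemma lp_norm_nonneg: "0 \<le> lp_norm M p f"
  unfolding lp_norm_def by simp

lemma lp_norm_powr:
  assumes "0 < p"
  shows "lp_norm M p f powr p = (\<integral>x. norm (f x) powr p \<partial>M)"
  using assms unfolding lp_norm_def by (simp add: powr_powr)

text \<open>For positive \<open>x\<close> and \<open>y\<close> this is \<open>powr_convex\<close>.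
  If one of them vanishes, it follows from \<open>scale\<close>, which rests on
  \<open>l powr p \<le> l\<close> for \<open>l\<close> in the unit interval.\<close>

lemma convex_on_powr_nonneg:
  fixes p :: real
  assumes "1 \<le> p"
  shows "convex_on {0..} (\<lambda>x. x powr p)"
proof (rule convex_onI)
  have scale: "(l * z) powr p \<le> l * z powr p" if "0 \<le> l" "l \<le> 1" "0 \<le> z" for l z :: real
    using powr_mono'[of 1 p l] that assms by (simp add: powr_mult mult_right_mono)
  fix t x y :: real
  assume t: "0 < t" "t < 1" and xy: "x \<in> {0..}" "y \<in> {0..}"
  show "((1 - t) *\<^sub>R x + t *\<^sub>R y) powr p \<le> (1 - t) * x powr p + t * y powr p"
  proof (cases "x = 0 \<or> y = 0")
    case True
    thus ?thesis using scale[of t y] scale[of "1 - t" x] t xy assms by auto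
  next
    case False
    thus ?thesis using convex_onD[OF powr_convex[OF assms], of t x y] t xy by auto
  qed
qed simp

text \<open>
  By convexity of the \<open>p\<close>-th power: \<open>a + b\<close> is \<open>s + t\<close> times the convex combination of
  \<open>a / s\<close> and \<open>b / t\<close> with weights \<open>s / (s + t)\<close> and \<open>t / (s + t)\<close>.
\<close>
lemma powr_add_le_weighted:
  fixes a b s t p :: real
  assumes "1 \<le> p" "0 \<le> a" "0 \<le> b" "0 < s" "0 < t"
  shows "(a + b) powr p \<le>
           (s + t) powr p * (s / (s + t) * (a powr p / s powr p) + t / (s + t) * (b powr p / t powr p))"
proof -
  have w: "1 - t / (s + t) = s / (s + t)"
    using assms by (simp add: field_simps)
  have "((1 - t / (s + t)) *\<^sub>R (a / s) + (t / (s + t)) *\<^sub>R (b / t)) powr p \<le>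
      (1 - t / (s + t)) * (a / s) powr p + t / (s + t) * (b / t) powr p"
    using assms by (intro convex_onD[OF convex_on_powr_nonneg]) auto
  also have "(1 - t / (s + t)) *\<^sub>R (a / s) + (t / (s + t)) *\<^sub>R (b / t) = (a + b) / (s + t)"
    unfolding w using assms by (simp add: add_divide_distrib)
  finally have "((a + b) / (s + t)) powr p \<le>
      s / (s + t) * (a / s) powr p + t / (s + t) * (b / t) powr p"
    unfolding w .
  thus ?thesis
    using assms by (simp add: powr_divide pos_divide_le_eq mult.commute)
qed

text \<open>Minkowski's inequality: integrate \<open>powr_add_le_weighted\<close> with
  \<open>s\<close> and \<open>t\<close> just above the two norms. Both normalized integrals are then
  at most 1, and the weights add up to 1.\<close>

lemma lp_norm_triangle:
  assumes p: "1 \<le> p"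
    and f: "integrable M (\<lambda>x. norm (f x) powr p)"
    and g: "integrable M (\<lambda>x. norm (g x) powr p)"
  shows "lp_norm M p (\<lambda>x. f x + g x) \<le> lp_norm M p f + lp_norm M p g"
proof (rule field_le_epsilon)
  fix e :: real assume "0 < e"
  define s where "s = lp_norm M p f + e / 2"
  define t where "t = lp_norm M p g + e / 2"
  \<comment> \<open>Adding \<open>e / 2\<close> makes the denominators positive even when a norm vanishes.\<close>
  have st: "0 < s" "0 < t" "lp_norm M p f \<le> s" "lp_norm M p g \<le> t"
    using \<open>0 < e\<close> lp_norm_nonneg[of M p f] lp_norm_nonneg[of M p g] unfolding s_def t_def by auto
  let ?F = "\<lambda>x. norm (f x) powr p" and ?G = "\<lambda>x. norm (g x) powr p"
  have Fs: "(\<integral>x. ?F x \<partial>M) / s powr p \<le> 1" and Gt: "(\<integral>x. ?G x \<partial>M) / t powr p \<le> 1"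
    using st p powr_mono2[of p "lp_norm M p f" s] powr_mono2[of p "lp_norm M p g" t]
    by (auto simp: lp_norm_nonneg lp_norm_powr)
  let ?B = "\<lambda>x. (s + t) powr p * (s / (s + t) * (?F x / s powr p) + t / (s + t) * (?G x / t powr p))"
  have "(\<integral>x. norm (f x + g x) powr p \<partial>M) \<le> (\<integral>x. ?B x \<partial>M)"
  proof (rule integral_mono')
    show "integrable M ?B" using f g by simp
    show "norm (f x + g x) powr p \<le> ?B x" for x
    proof -
      have "norm (f x + g x) powr p \<le> (norm (f x) + norm (g x)) powr p"
        using p by (intro powr_mono2 norm_triangle_ineq) auto
      also have "\<dots> \<le> ?B x"
        using p st by (intro powr_add_le_weighted) auto
      finally show ?thesis .
    qed
    \<comment> \<open>Covers the case that the left integrand is not integrable, where its integral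
      is 0 by default.\<close>
    show "0 \<le> ?B x" for x using st by (intro mult_nonneg_nonneg add_nonneg_nonneg) auto
  qed
  also have "\<dots> = (s + t) powr p * (s / (s + t) * ((\<integral>x. ?F x \<partial>M) / s powr p)
                                   + t / (s + t) * ((\<integral>x. ?G x \<partial>M) / t powr p))"
    using f g by simp
  also have "\<dots> \<le> (s + t) powr p * (s / (s + t) * 1 + t / (s + t) * 1)"
    using st by (intro mult_left_mono add_mono Fs Gt) auto
  also have "s / (s + t) * 1 + t / (s + t) * 1 = 1"
    using st by (simp add: add_divide_distrib[symmetric])
  finally have "lp_norm M p (\<lambda>x. f x + g x) \<le> ((s + t) powr p) powr (1 / p)"
    unfolding lp_norm_def using p by (intro powr_mono2) (auto intro: integral_nonneg)
  also have "\<dots> = s + t" using p st by (simp add: powr_powr)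
  finally show "lp_norm M p (\<lambda>x. f x + g x) \<le> lp_norm M p f + lp_norm M p g + e"
    by (simp add: s_def t_def)
qed

text \<open>Total mass 1 is what makes the constant exactly \<open>b\<close>.\<close>

lemma (in prob_space) lp_norm_le_bound:
  assumes "0 < p" "\<And>x. x \<in> space M \<Longrightarrow> norm (f x) \<le> b" "0 \<le> b"
  shows "lp_norm M p f \<le> b"
proof -
  have "(\<integral>x. norm (f x) powr p \<partial>M) \<le> (\<integral>x. b powr p \<partial>M)"
    using assms by (intro integral_mono') (auto intro: powr_mono2)
  hence "lp_norm M p f \<le> (b powr p) powr (1 / p)"
    unfolding lp_norm_def using assms by (intro powr_mono2) (auto simp: prob_space)
  thus ?thesis using assms by (simp add: powr_powr)
qed

text \<open>Compactness bounds the set of values, so that the real \<open>SUP\<close> is a genuine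
  supremum.\<close>

lemma norm_le_sup_norm:
  assumes "compact \<Omega>" "continuous_on \<Omega> f" "x \<in> \<Omega>"
  shows "norm (f x) \<le> sup_norm \<Omega> f"
proof -
  have "bounded ((\<lambda>x. norm (f x)) ` \<Omega>)"
    using assms by (intro compact_imp_bounded compact_continuous_image continuous_on_norm)
  thus ?thesis
    unfolding sup_norm_def using assms(3) by (intro cSUP_upper bounded_imp_bdd_above)
qed

text \<open>The integrand is bounded by compactness and measurable because \<open>M\<close> contains
  the relative Borel sets; the inclusion also admits completed measures.\<close>

lemma integrable_norm_powr_continuous_on:
  fixes M :: "'a::topological_space measure" and f :: "'a \<Rightarrow> 'k::real_normed_field"
  assumes "finite_measure M" and "compact (space M)" "sets (restrict_space borel (space M)) \<subseteq> sets M"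
    and f: "continuous_on (space M) f" and "0 \<le> p"
  shows "integrable M (\<lambda>x. norm (f x) powr p)"
proof (rule finite_measure.integrable_const_bound[OF assms(1)])
  show "AE x in M. norm (norm (f x) powr p) \<le> sup_norm (space M) f powr p"
    using norm_le_sup_norm[OF assms(2) f] \<open>0 \<le> p\<close> by (auto intro!: powr_mono2)
  have "(\<lambda>x. norm (f x)) \<in> borel_measurable (restrict_space borel (space M))"
    by (intro borel_measurable_continuous_on_restrict continuous_on_norm f)
  hence "(\<lambda>x. norm (f x)) \<in> borel_measurable M"
    using assms(3) by (auto simp: measurable_def space_restrict_space)
  thus "(\<lambda>x. norm (f x) powr p) \<in> borel_measurable M" by measurable
qed

lemma continuous_on_lin_span:
  assumes "u \<in> lin_span g J" "\<And>j. j \<in> J \<Longrightarrow> continuous_on \<Omega> (g j)"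
  shows "continuous_on \<Omega> u"
  using assms unfolding lin_span_def by (auto intro!: continuous_intros)

lemma lin_span_diff:
  assumes "u \<in> lin_span g J" "w \<in> lin_span g J"
  shows "(\<lambda>x. u x - w x) \<in> lin_span g J"
  using lin_span_add[OF assms(2,1), of "-1"] by simp

theorem theorem6p1:
  fixes \<Omega> :: "'a::euclidean_space set"
    and \<mu> :: "'a measure"
    and p D :: real
    and m v N :: nat
    and g :: "nat \<Rightarrow> 'a \<Rightarrow> 'k::real_normed_field"
    and \<xi> :: "nat \<Rightarrow> 'a"
  assumes "compact \<Omega>"
    and "prob_space \<mu>" and "space \<mu> = \<Omega>" and "sets (restrict_space borel \<Omega>) \<subseteq> sets \<mu>"
    and "1 \<le> p"
    and "1 \<le> m" and "v \<le> N"
    and "\<And>i. i \<in> {1..N} \<Longrightarrow> continuous_on \<Omega> (g i)"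
    and "1 \<le> D"
    and "\<And>j. j \<in> {1..m} \<Longrightarrow> \<xi> j \<in> \<Omega>"
    and "\<And>h. h \<in> \<Union> (vterm_spaces g N v) \<Longrightarrow> lp_norm \<mu> p h \<le> D * max_norm m \<xi> h"
    and "linf_selector \<Omega> m \<xi> (vterm_spaces g N v) A"
    and "space_selector \<Omega> \<mu> p (vterm_spaces g N v) A S"
  shows "\<forall>f. continuous_on \<Omega> f \<longrightarrow>
           lp_norm \<mu> p (\<lambda>x. f x - alg_lp_inf A S f x) \<le> (2 * D + 1) * best_vterm_error \<Omega> g N v f"
proof (intro allI impI)
  fix f :: "'a \<Rightarrow> 'k" assume f: "continuous_on \<Omega> f"
  interpret prob_space \<mu> by (rule assms(2))
  let ?X = "vterm_spaces g N v"
  \<comment> \<open>Dividing by the constant gives a lower bound for every single error, hence for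
    their infimum, whether or not it is attained.\<close>
  have "lp_norm \<mu> p (\<lambda>x. f x - alg_lp_inf A S f x) / (2 * D + 1) \<le> sup_norm \<Omega> (\<lambda>x. f x - h x)"
    if "h \<in> vterm_approximants g N v" for h
  proof -
    let ?e = "sup_norm \<Omega> (\<lambda>x. f x - h x)"
    from that obtain J where J: "J \<subseteq> {1..N}" "card J = v" and hJ: "h \<in> lin_span g J"
      unfolding vterm_approximants_def vterm_spaces_def by blast
    hence LX: "lin_span g J \<in> ?X" unfolding vterm_spaces_def by blast
    \<comment> \<open>The comparison takes place in a space containing \<open>h\<close>, not in
      \<open>S f\<close>: then \<open>h - ?u\<close> lies in one \<open>v\<close>-term space and the
      discretization hypothesis applies, although the union of these spaces need not be closed under
      subtraction.\<close>
    let ?u = "A (lin_span g J) f"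
    have uJ: "?u \<in> lin_span g J"
      and umin: "max_norm m \<xi> (\<lambda>x. f x - ?u x) \<le> max_norm m \<xi> (\<lambda>x. f x - h x)"
      using assms(12) LX f hJ unfolding linf_selector_def is_arg_min_linorder by blast+
    have cont: "continuous_on \<Omega> w" if "w \<in> lin_span g J" for w
      using that J(1) assms(8) by (intro continuous_on_lin_span[of w g J]) auto
    have fh: "continuous_on \<Omega> (\<lambda>x. f x - h x)"
      and hu: "continuous_on \<Omega> (\<lambda>x. h x - ?u x)"
      using f cont hJ uJ by (auto intro!: continuous_on_diff)
    have e: "norm (f x - h x) \<le> ?e" if "x \<in> \<Omega>" for x
      using norm_le_sup_norm[OF assms(1) fh that] .
    \<comment> \<open>The point \<open>\<xi> 1\<close> witnesses that \<open>\<Omega>\<close> is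
      nonempty.\<close>
    have e0: "0 \<le> ?e" using order_trans[OF norm_ge_zero e[of "\<xi> 1"]] assms(6,10) by auto
    have fh_max: "max_norm m \<xi> (\<lambda>x. f x - h x) \<le> ?e"
      using assms(6,10) e by (simp add: max_norm_le_iff)
    have int: "integrable \<mu> (\<lambda>x. norm (w x) powr p)" if "continuous_on \<Omega> w" for w :: "'a \<Rightarrow> 'k"
      using that assms(1,3,4,5) finite_measure_axioms by (intro integrable_norm_powr_continuous_on) auto
    \<comment> \<open>Write \<open>h - ?u\<close> as \<open>-(f - h) + (f - ?u)\<close>; each part
      contributes one \<open>?e\<close>, whence the 2 in \<open>2 * D + 1\<close>.\<close>
    have "max_norm m \<xi> (\<lambda>x. h x - ?u x)
        \<le> max_norm m \<xi> (\<lambda>x. -1 * (f x - h x)) + max_norm m \<xi> (\<lambda>x. f x - ?u x)"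
      by (rule max_norm_triangle[OF assms(6)]) simp
    also have "max_norm m \<xi> (\<lambda>x. -1 * (f x - h x)) \<le> max_norm m \<xi> (\<lambda>x. f x - h x)"
      using max_norm_scale_le[OF assms(6), of \<xi> "-1" "\<lambda>x. f x - h x"] by simp
    finally have hu_max: "max_norm m \<xi> (\<lambda>x. h x - ?u x) \<le> 2 * ?e"
      using umin fh_max by simp
    have "lp_norm \<mu> p (\<lambda>x. f x - alg_lp_inf A S f x) \<le> lp_norm \<mu> p (\<lambda>x. f x - ?u x)"
      using assms(13) f LX unfolding space_selector_def is_arg_min_linorder alg_lp_inf_def by blast
    also have "\<dots> \<le> lp_norm \<mu> p (\<lambda>x. f x - h x) + lp_norm \<mu> p (\<lambda>x. h x - ?u x)"
      using lp_norm_triangle[OF assms(5) int[OF fh] int[OF hu]] by simp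
    also have "lp_norm \<mu> p (\<lambda>x. f x - h x) \<le> ?e"
      using e e0 assms(3,5) by (intro lp_norm_le_bound) auto
    also have "lp_norm \<mu> p (\<lambda>x. h x - ?u x) \<le> D * max_norm m \<xi> (\<lambda>x. h x - ?u x)"
      using lin_span_diff[OF hJ uJ] LX by (intro assms(11)) blast
    also have "\<dots> \<le> D * (2 * ?e)"
      using hu_max assms(9) by (intro mult_left_mono) auto
    finally show ?thesis using assms(9) by (simp add: pos_divide_le_eq algebra_simps)
  qed
  \<comment> \<open>Nonemptiness is required by \<open>cINF_greatest\<close>;
    \<open>v \<le> N\<close> supplies an index set of size \<open>v\<close>.\<close>
  moreover have "vterm_approximants g N v \<noteq> {}"
  proof -
    have "lin_span g {1..v} \<in> ?X" unfolding vterm_spaces_def using assms(7) by force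
    thus ?thesis unfolding vterm_approximants_def using lin_span_zero by blast
  qed
  ultimately have "lp_norm \<mu> p (\<lambda>x. f x - alg_lp_inf A S f x) / (2 * D + 1) \<le> best_vterm_error \<Omega> g N v f"
    unfolding best_vterm_error_def by (intro cINF_greatest)
  thus "lp_norm \<mu> p (\<lambda>x. f x - alg_lp_inf A S f x) \<le> (2 * D + 1) * best_vterm_error \<Omega> g N v f"
    using assms(9) by (simp add: pos_divide_le_eq mult.commute)
qed

end
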